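(* Let $m<0$ be a squarefree integer, let $\sqrt{m}=i\sqrt{|m|}$, and let $\theta=\arg(1+\sqrt{m})$ (principal argument). Let $\mathcal{O}(\mathbb{Q}(\sqrt{m}))$ denote the ring of algebraic integers in $\mathbb{Q}(\sqrt{m})$. Then $\mathcal{O}(\mathbb{Q}(\sqrt{m}))=R(U)$ (as subsets of $\mathbb{C}$), where (1) $U=\{1,\,i,\,e^{i\theta}\}$, if $m\equiv 2$ or $3 \pmod 4$; (2) $U=\{1,\,e^{i\theta},\,e^{i(\pi-\theta)}\}$, if $m\equiv 1\pmod 4$.
   Context: Let $\mathbb{T}=\{z\in\mathbb{C}:|z|=1\}$ and let $U\subset\mathbb{T}$ be a set of directions. For $u\in U$ and $p\in\mathbb{C}$, let $L_u(p)=\{p+ru: r\in\mathbb{R}\}$ be the line through $p$ in direction $u$; $u$ and $-u$ define the same lines. If $u,v\in U$ determine distinct directions (that is, $u\neq\pm v$), let $I_{u,v}(p,q)$ denote the unique point of $L_u(p)\cap L_v(q)$. The set $R(U)$ is the smallest subset of $\mathbb{C}$ that contains $0$ and $1$ and that contains $I_{u,v}(p,q)$ whenever it contains $p$ and $q$ and $u,v\in U$ determine distinct directions. *)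

theory Defs
  imports
    "HOL-Analysis.Analysis"
    "HOL-Algebra.Generated_Fields"
    "HOL-Algebra.Algebraic_Closure_Type"
    "HOL-Computational_Algebra.Squarefree"
    "HOL-Number_Theory.Cong"
begin

definition dir_line :: "complex \<Rightarrow> complex \<Rightarrow> complex set" where
  "dir_line u p = {p + of_real r * u | r :: real. True}"

definition line_inter :: "complex \<Rightarrow> complex \<Rightarrow> complex \<Rightarrow> complex \<Rightarrow> complex" where
  "line_inter u v p q = (THE z. z \<in> dir_line u p \<inter> dir_line v q)"

text \<open>The description in \<^const>\<open>line_inter\<close> is meaningful for distinct directions:\<close>

lemma line_inter_ex1:
  assumes "norm u = 1" "norm v = 1" "u \<noteq> v" "u \<noteq> - v"
  shows "\<exists>!z. z \<in> dir_line u p \<inter> dir_line v q"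
proof -
  define d where "d = Re u * Im v - Im u * Re v"
  have n: "(Re u)\<^sup>2 + (Im u)\<^sup>2 = 1" "(Re v)\<^sup>2 + (Im v)\<^sup>2 = 1"
    using assms(1,2) by (simp_all add: cmod_def)
  have "d \<noteq> 0"
  proof
    assume d: "d = 0"
    define c where "c = Re u * Re v + Im u * Im v"
    have "c\<^sup>2 + d\<^sup>2 = ((Re u)\<^sup>2 + (Im u)\<^sup>2) * ((Re v)\<^sup>2 + (Im v)\<^sup>2)"
      unfolding c_def d_def by (simp add: power2_eq_square algebra_simps)
    hence "c\<^sup>2 = 1" using n d by simp
    hence c: "c = 1 \<or> c = -1" by (simp add: power2_eq_1_iff)
    have "c * Re v - d * Im v * (-1) = Re u * ((Re v)\<^sup>2 + (Im v)\<^sup>2)"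
         "c * Im v - d * Re v = Im u * ((Re v)\<^sup>2 + (Im v)\<^sup>2)"
      unfolding c_def d_def by (simp_all add: power2_eq_square algebra_simps)
    hence "Re u = c * Re v" "Im u = c * Im v" using n d by simp_all
    thus False using c assms(3,4) by (auto simp: complex_eq_iff)
  qed
  define a where "a = ((Re q - Re p) * Im v - (Im q - Im p) * Re v) / d"
  define b where "b = ((Re q - Re p) * Im u - (Im q - Im p) * Re u) / d"
  have *: "p + of_real r * u = q + of_real s * v \<longleftrightarrow> r = a \<and> s = b" for r s
  proof
    assume "p + of_real r * u = q + of_real s * v"
    hence e: "r * Re u - s * Re v = Re q - Re p" "r * Im u - s * Im v = Im q - Im p"
      by (simp_all add: complex_eq_iff)
    have "r * d = (Re q - Re p) * Im v - (Im q - Im p) * Re v"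
         "s * d = (Re q - Re p) * Im u - (Im q - Im p) * Re u"
      unfolding e[symmetric] d_def by (simp_all add: algebra_simps)
    thus "r = a \<and> s = b" using \<open>d \<noteq> 0\<close> by (simp add: a_def b_def field_simps)
  next
    assume "r = a \<and> s = b"
    hence rs: "r * d = (Re q - Re p) * Im v - (Im q - Im p) * Re v"
              "s * d = (Re q - Re p) * Im u - (Im q - Im p) * Re u"
      using \<open>d \<noteq> 0\<close> by (simp_all add: a_def b_def)
    have "(r * Re u - s * Re v) * d = (r * d) * Re u - (s * d) * Re v"
         "(r * Im u - s * Im v) * d = (r * d) * Im u - (s * d) * Im v"
      by (simp_all add: algebra_simps)
    hence "(r * Re u - s * Re v) * d = (Re q - Re p) * d"
          "(r * Im u - s * Im v) * d = (Im q - Im p) * d"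
      unfolding rs by (simp_all add: d_def algebra_simps)
    hence "r * Re u - s * Re v = Re q - Re p" "r * Im u - s * Im v = Im q - Im p"
      using \<open>d \<noteq> 0\<close> by simp_all
    thus "p + of_real r * u = q + of_real s * v"
      by (simp add: complex_eq_iff algebra_simps)
  qed
  show ?thesis
  proof (rule ex1I[of _ "p + of_real a * u"])
    show "p + of_real a * u \<in> dir_line u p \<inter> dir_line v q"
      using *[of a b] unfolding dir_line_def by blast
    show "z = p + of_real a * u" if "z \<in> dir_line u p \<inter> dir_line v q" for z
      using that * by (auto simp: dir_line_def)
  qed
qed

text \<open>Intended for sets \<^term>\<open>U\<close> of unit complex numbers.\<close>

inductive_set origami_set :: "complex set \<Rightarrow> complex set" for U where
  zero: "0 \<in> origami_set U"
| one: "1 \<in> origami_set U"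
| inter: "\<lbrakk>p \<in> origami_set U; q \<in> origami_set U; u \<in> U; v \<in> U; u \<noteq> v; u \<noteq> - v\<rbrakk>
    \<Longrightarrow> line_inter u v p q \<in> origami_set U"

definition rat_adjoin :: "complex \<Rightarrow> complex set" where
  "rat_adjoin x = generate_field (ring_of_type_algebra :: complex ring) (\<rat> \<union> {x})"

definition ring_of_integers :: "complex set \<Rightarrow> complex set" where
  "ring_of_integers K = {x \<in> K. algebraic_int x}"

end

theory Submission
  imports Defs
begin

text \<open>Put \<open>w = 1 + \<surd>m\<close> in case (1) and \<open>w = (1 + \<surd>m) / 2\<close> in case (2). Up to real factors, the three
  directions are \<open>1\<close>, \<open>w\<close> and \<open>w - 1\<close> in both cases, so intersecting lines acts on the coordinates of
  \<open>a + b w\<close> by integral formulas, and these formulas produce all of \<open>\<int> + \<int> w\<close> from \<open>0\<close> and \<open>1\<close>. This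
  lattice is the ring of integers: an element of \<open>\<rat>(\<surd>m)\<close> is integral iff its trace and norm are
  integers, i.e. iff it is \<open>(A + B \<surd>m) / 2\<close> with \<open>4 dvd A\<^sup>2 - m B\<^sup>2\<close>.\<close>

section \<open>Intersections of lines, and origami sets that are lattices\<close>

lemma dir_line_iff: "z \<in> dir_line u p \<longleftrightarrow> (\<exists>r :: real. z = p + of_real r * u)"
  by (auto simp: dir_line_def)

lemma line_inter_eqI:
  assumes "norm u = 1" "norm v = 1" "u \<noteq> v" "u \<noteq> - v"
    and "z \<in> dir_line u p" "z \<in> dir_line v q"
  shows "line_inter u v p q = z"
  unfolding line_inter_def using line_inter_ex1[OF assms(1-4)] assms(5,6)
  by (intro the1_equality) auto

lemma line_inter_commute: "line_inter u v p q = line_inter v u q p"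
  by (simp add: line_inter_def Int_commute)

text \<open>Lets displacements be measured by the unnormalized vector \<open>w\<close> instead of
  \<open>u\<close>, so that between lattice points the parameter is an integer.\<close>

lemma dir_lineI:
  assumes "w = of_real c * u" and "z - p = of_int n * w"
  shows "z \<in> dir_line u p"
proof -
  have "z = p + of_real (of_int n * c) * u"
    using assms by (simp add: algebra_simps)
  thus ?thesis unfolding dir_line_iff by blast
qed

text \<open>In the coordinates \<open>(a, b) \<mapsto> a + b w\<close> the three directions keep \<open>b\<close>, \<open>a\<close> and \<open>a + b\<close>
  constant, respectively.\<close>

locale lattice_directions =
  fixes w u v :: complex and c d :: real
  assumes Im_w: "Im w \<noteq> 0" and unit: "norm u = 1" "norm v = 1"
    and w_eq: "w = of_real c * u" and w1_eq: "w - 1 = of_real d * v"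
begin

text \<open>As \<open>Im w\<close> is nonzero, \<open>1\<close>, \<open>w\<close> and
  \<open>w - 1\<close> are pairwise linearly independent over the reals.\<close>

lemma distinct:
  "1 \<noteq> u" "1 \<noteq> - u" "1 \<noteq> v" "1 \<noteq> - v" "u \<noteq> v" "u \<noteq> - v"
proof -
  have *: "Im w = c * Im u" "Re w = c * Re u" "Im w = d * Im v" "Re w - 1 = d * Re v"
    using w_eq arg_cong[OF w1_eq, of Re] arg_cong[OF w1_eq, of Im] by simp_all
  show "1 \<noteq> u" "1 \<noteq> - u" "1 \<noteq> v" "1 \<noteq> - v"
    using * Im_w by (auto simp: complex_eq_iff)
  show "u \<noteq> v"
  proof
    assume "u = v"
    hence "c = d" "c * Re v = d * Re v + 1" using * Im_w by auto
    thus False by simp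
  qed
  show "u \<noteq> - v"
  proof
    assume "u = - v"
    hence "(c + d) * Im v = 0" "- c * Re v = d * Re v + 1" "Im v \<noteq> 0"
      using * Im_w by (auto simp: algebra_simps)
    hence "c = - d" "- c * Re v = d * Re v + 1" by auto
    thus False by simp
  qed
qed

lemma inter_1_u: "line_inter 1 u (of_int a + of_int b * w) (of_int a' + of_int b' * w) = of_int a' + of_int b * w"
  \<comment> \<open>The integers given to \<open>dir_lineI\<close> are the numbers of steps from the
    two base points to the intersection, here along \<open>1\<close> and along
    \<open>w\<close>.\<close>
  by (rule line_inter_eqI)
     (use unit distinct in \<open>auto intro: dir_lineI[of 1 1 1 _ _ "a' - a"] dir_lineI[OF w_eq, of _ _ "b - b'"]
       simp: algebra_simps\<close>)

lemma inter_1_v: "line_inter 1 v (of_int a + of_int b * w) (of_int a' + of_int b' * w) =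
    of_int (a' + b' - b) + of_int b * w"
  by (rule line_inter_eqI)
     (use unit distinct in \<open>auto intro: dir_lineI[of 1 1 1 _ _ "a' + b' - b - a"] dir_lineI[OF w1_eq, of _ _ "b - b'"]
       simp: algebra_simps\<close>)

lemma inter_u_v: "line_inter u v (of_int a + of_int b * w) (of_int a' + of_int b' * w) =
    of_int a + of_int (a' + b' - a) * w"
  by (rule line_inter_eqI)
     (use unit distinct in \<open>auto intro: dir_lineI[OF w_eq, of _ _ "a' + b' - a - b"] dir_lineI[OF w1_eq, of _ _ "a' - a"]
       simp: algebra_simps\<close>)

text \<open>The intersection formulas have integer coefficients, so they never leave the lattice;
  \<open>line_inter_commute\<close> reduces the six ordered pairs of directions to three.\<close>

lemma origami_subset: "origami_set {1, u, v} \<subseteq> {of_int a + of_int b * w | a b. True}"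
proof
  have mem: "\<exists>a' b'. of_int a + of_int b * w = of_int a' + of_int b' * w" for a b by blast
  fix z assume "z \<in> origami_set {1, u, v}"
  thus "z \<in> {of_int a + of_int b * w | a b. True}"
  proof induction
    case zero
    have "0 = of_int 0 + of_int 0 * w" by simp
    thus ?case by blast
  next
    case one
    have "1 = of_int 1 + of_int 0 * w" by simp
    thus ?case by blast
  next
    case (inter p q s t)
    then obtain a b a' b' where pq: "p = of_int a + of_int b * w" "q = of_int a' + of_int b' * w"
      by blast
    have "(s, t) \<in> {(1, u), (u, 1), (1, v), (v, 1), (u, v), (v, u)}"
      using inter by blast
    thus ?case unfolding pq
      by (auto simp: inter_1_u inter_1_v inter_u_v mem
          line_inter_commute[of u 1] line_inter_commute[of v 1] line_inter_commute[of v u]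
          simp del: of_int_add of_int_diff)
  qed
qed

text \<open>With \<open>w\<close> and \<open>- w\<close> at hand, one can walk along the real axis
  in unit steps. The \<open>v\<close>-line through (b, 0) carries that point to (0, b), and
  \<open>cross\<close> combines (0, b) with (a, 0) into (a, b).\<close>

lemma subset_origami: "of_int a + of_int b * w \<in> origami_set {1, u, v}"
proof -
  define S where "S = (\<lambda>a b. of_int a + of_int b * w \<in> origami_set {1, u, v})"
  have S00: "S 0 0" and S10: "S 1 0"
    by (simp_all add: S_def origami_set.zero origami_set.one)
  have cross: "S a' b" if "S a b" "S a' b'" for a b a' b'
    using origami_set.inter[OF that[unfolded S_def], of 1 u] distinct
    unfolding inter_1_u S_def by simp
  have horizontal: "S (a' + b' - b) b" if "S a b" "S a' b'" for a b a' b'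
    using origami_set.inter[OF that[unfolded S_def], of 1 v] distinct
    unfolding inter_1_v S_def by simp
  have vertical: "S a (a' + b' - a)" if "S a b" "S a' b'" for a b a' b'
    using origami_set.inter[OF that[unfolded S_def], of u v] distinct
    unfolding inter_u_v S_def by simp
  have "S 0 1" using vertical[OF S00 S10] by simp
  \<comment> \<open>The \<open>u\<close>-line through 1 meets the \<open>v\<close>-line through 0 in
    \<open>1 - w\<close>; the horizontal line through that point meets the \<open>u\<close>-line
    through 0 in \<open>- w\<close>.\<close>
  have "S 0 (- 1)" using cross[OF vertical[OF S10 S00] S00] by simp
  have col: "S a 0" for a
  proof (induction a rule: int_induct[of _ 0])
    case base
    show ?case by (rule S00)
  next
    case (step1 i)
    \<comment> \<open>\<open>cross\<close> gives the point (i, 1), and the \<open>v\<close>-line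
      through it, on which the coordinate sum is \<open>i + 1\<close>, meets the real axis one step
      further. The downward step uses (i, -1) likewise.\<close>
    have "S (i + 1 - 0) 0"
      by (rule horizontal[OF S00 cross[OF \<open>S 0 1\<close> step1(2)]])
    thus ?case by simp
  next
    case (step2 i)
    have "S (i + (-1) - 0) 0"
      by (rule horizontal[OF S00 cross[OF \<open>S 0 (-1)\<close> step2(2)]])
    thus ?case by simp
  qed
  have "S 0 b" using vertical[OF S00 col[of b]] by simp
  thus ?thesis using cross[OF _ col[of a]] unfolding S_def by blast
qed

lemma origami_eq: "origami_set {1, u, v} = {of_int a + of_int b * w | a b. True}"
  using origami_subset subset_origami by blast

end

section \<open>Integer polynomials, and integrality of trace and norm\<close>

lemma poly_of_int_poly_add:
  "poly (map_poly of_int (p + q)) x =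
     poly (map_poly of_int p) x + poly (map_poly of_int q) (x :: 'a :: comm_ring_1)"
proof (induction p q rule: poly_induct2)
  case (pCons a p b q)
  then show ?case by (simp add: map_poly_pCons algebra_simps)
qed simp

lemma poly_of_int_poly_smult:
  "poly (map_poly of_int (Polynomial.smult c p)) x = of_int c * poly (map_poly of_int p) (x :: 'a :: comm_ring_1)"
  by (induction p) (simp_all add: map_poly_pCons algebra_simps)

lemma poly_of_int_poly_mult:
  "poly (map_poly of_int (p * q)) x =
     poly (map_poly of_int p) x * poly (map_poly of_int q) (x :: 'a :: comm_ring_1)"
  by (induction p)
     (simp_all add: map_poly_pCons poly_of_int_poly_add poly_of_int_poly_smult algebra_simps)

text \<open>Pseudo-division keeps the argument inside \<open>\<int>[X]\<close>: it gives \<open>aP = fg\<close> for a monic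
  \<open>P\<close> vanishing at \<open>x\<close>, and comparing contents lets one cancel \<open>a\<close>.\<close>

lemma algebraic_int_minimal_primitive_lead_coeff:
  fixes x :: "'a :: field_char_0" and f :: "int poly"
  assumes "algebraic_int x" and "content f = 1" and "poly (map_poly of_int f) x = 0"
    and minimal: "\<And>r :: int poly. poly (map_poly of_int r) x = 0 \<Longrightarrow> Polynomial.degree r < Polynomial.degree f \<Longrightarrow> r = 0"
  shows "Polynomial.lead_coeff f dvd 1"
proof -
  obtain P :: "int poly" where P: "poly (map_poly of_int P) x = 0" "Polynomial.lead_coeff P = 1"
    using assms(1) unfolding algebraic_int_altdef_ipoly by blast
  have "f \<noteq> 0" using assms(2) by auto
  define r where "r = pseudo_mod P f"
  obtain a g where ag: "a \<noteq> 0" "Polynomial.smult a P = f * g + r"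
    using pseudo_mod(1)[OF \<open>f \<noteq> 0\<close>, of P] unfolding r_def by blast
  have "poly (map_poly of_int (Polynomial.smult a P)) x = poly (map_poly of_int r) x"
    unfolding ag(2) poly_of_int_poly_add poly_of_int_poly_mult by (simp add: assms(3))
  hence "poly (map_poly of_int r) x = 0"
    by (simp add: poly_of_int_poly_smult P(1))
  hence "r = 0"
    using pseudo_mod(2)[OF \<open>f \<noteq> 0\<close>, of P] minimal unfolding r_def by blast
  hence fg: "Polynomial.smult a P = f * g" using ag(2) by simp
  have "content g = content (Polynomial.smult a P)"
    unfolding fg by (simp add: content_mult assms(2))
  hence "a dvd content g" by simp
  hence "[:a:] dvd g" by (simp add: const_poly_dvd_iff_dvd_content)
  then obtain h where "g = Polynomial.smult a h" by (auto elim: dvdE)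
  hence "Polynomial.smult a P = Polynomial.smult a (f * h)" using fg by simp
  hence "Polynomial.smult a (P - f * h) = 0" by (simp add: smult_diff_right)
  hence "P = f * h" using ag(1) by simp
  hence "Polynomial.lead_coeff f * Polynomial.lead_coeff h = 1" using P(2) by (simp add: lead_coeff_mult)
  thus ?thesis by (metis dvd_triv_left)
qed

text \<open>A nonreal \<open>x\<close> is a root of the rational quadratic with trace
  \<open>2 * Re x\<close> and norm \<open>(cmod x)\<^sup>2\<close>, and of no nonzero integer
  polynomial of lower degree. The primitive multiple of that quadratic thus has a unit as leading
  coefficient. A real \<open>x\<close> is a rational algebraic integer.\<close>

lemma algebraic_int_trace_norm_Ints:
  fixes x :: complex
  assumes "algebraic_int x" and "2 * Re x \<in> \<rat>" and "(cmod x)\<^sup>2 \<in> \<rat>"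
  shows "2 * Re x \<in> \<int>" and "(cmod x)\<^sup>2 \<in> \<int>"
proof -
  have "2 * Re x \<in> \<int> \<and> (cmod x)\<^sup>2 \<in> \<int>"
  proof (cases "Im x = 0")
    case True
    have "Re x \<in> \<rat>" using Rats_divide[OF assms(2), of 2] by simp
    moreover have "algebraic_int (Re x)"
      using assms(1) True by (metis algebraic_int_of_real_iff complex_is_Real_iff of_real_Re)
    ultimately have "Re x \<in> \<int>" by (intro rational_algebraic_int_is_int)
    thus ?thesis using True by (simp add: cmod_power2)
  next
    case False
    obtain a b where ab: "b > 0" "2 * Re x = of_int a / of_int b"
      using assms(2) by (elim Rats_cases')
    obtain c d where cd: "d > 0" "(cmod x)\<^sup>2 = of_int c / of_int d"
      using assms(3) by (elim Rats_cases')
    \<comment> \<open>This is \<open>X^2 - (a/b) X + c/d\<close> cleared of denominators by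
      \<open>b * d\<close>, constant term first.\<close>
    define f where "f = [:c * b, - (a * d), b * d:]"
    define g where "g = primitive_part f"
    have "f \<noteq> 0" using ab cd by (simp add: f_def)
    have g: "Polynomial.smult (content f) g = f" by (simp add: g_def)
    have cf: "content f \<noteq> 0" using \<open>f \<noteq> 0\<close> by simp
    have "Polynomial.degree f = 2" using ab cd by (simp add: f_def)
    hence dg: "Polynomial.degree g = 2" by (simp add: g_def)
    have quad: "x\<^sup>2 - of_real (2 * Re x) * x + of_real ((cmod x)\<^sup>2) = 0"
      unfolding cmod_power2 by (simp add: complex_eq_iff power2_eq_square algebra_simps)
    have eval: "poly (map_poly of_int f) x =
        of_int (b * d) * (x\<^sup>2 - of_real (2 * Re x) * x + of_real ((cmod x)\<^sup>2))"
      unfolding ab cd using ab(1) cd(1)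
      by (simp add: f_def map_poly_pCons field_simps power2_eq_square)
    have "poly (map_poly of_int (Polynomial.smult (content f) g)) x = 0"
      unfolding g eval quad by simp
    hence root: "poly (map_poly of_int g) x = 0"
      using cf by (simp add: poly_of_int_poly_smult)
    have "Polynomial.lead_coeff g dvd 1"
    proof (rule algebraic_int_minimal_primitive_lead_coeff[OF assms(1) _ root])
      show "content g = 1" using \<open>f \<noteq> 0\<close> by (simp add: g_def)
      fix r :: "int poly" assume r: "poly (map_poly of_int r) x = 0" "Polynomial.degree r < Polynomial.degree g"
      obtain k l where kl: "r = [:k, l:]"
      proof (cases r)
        case (pCons k r')
        show ?thesis
          by (cases r') (use r(2) pCons dg that in \<open>auto split: if_splits\<close>)
      qed
      have "of_int k + of_int l * x = 0" using r(1) unfolding kl by (simp add: map_poly_pCons mult.commute)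
      hence "real_of_int l * Im x = 0" "real_of_int k + real_of_int l * Re x = 0"
        by (simp_all add: complex_eq_iff)
      thus "r = 0" using False by (simp add: kl)
    qed
    have bd: "b * d = content f * Polynomial.coeff g 2" "a * d = - content f * Polynomial.coeff g 1"
      "c * b = content f * Polynomial.coeff g 0"
      using arg_cong[OF g, of "\<lambda>p. Polynomial.coeff p 2"] arg_cong[OF g, of "\<lambda>p. Polynomial.coeff p 1"]
        arg_cong[OF g, of "\<lambda>p. Polynomial.coeff p 0"]
      by (simp_all add: f_def numeral_2_eq_2)
    \<comment> \<open>As \<open>coeff g 2\<close> is a unit, \<open>b * d\<close> divides the
      content of \<open>f\<close> and so its other coefficients; cancelling \<open>d\<close> and
      \<open>b\<close> removes both denominators.\<close>
    have "b * d dvd content f"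
      using \<open>Polynomial.lead_coeff g dvd 1\<close> unfolding bd dg by simp
    hence "b * d dvd a * d" "b * d dvd c * b"
      unfolding bd(2,3) by (simp_all add: dvd_mult2)
    hence "b dvd a" "d dvd c" using ab(1) cd(1) by (auto simp: mult.commute)
    thus ?thesis
      using ab cd by (auto elim!: dvdE)
  qed
  thus "2 * Re x \<in> \<int>" "(cmod x)\<^sup>2 \<in> \<int>" by blast+
qed

section \<open>The field generated by an imaginary square root\<close>

text \<open>\<open>generate_field\<close> speaks of the inverses in the ring record; this lemma and
  the next carry them over to the type class operations.\<close>

lemma a_inv_ring_of_type_algebra: "\<ominus>\<^bsub>ring_of_type_algebra\<^esub> x = - (x :: 'a :: field)"
proof -
  interpret field "ring_of_type_algebra :: 'a ring" by (rule field_from_type_algebra)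
  show ?thesis by (rule minus_equality) (simp_all add: ring_of_type_algebra_def)
qed

lemma m_inv_ring_of_type_algebra:
  assumes "x \<noteq> 0"
  shows "inv\<^bsub>ring_of_type_algebra\<^esub> x = inverse (x :: 'a :: field)"
proof -
  interpret field "ring_of_type_algebra :: 'a ring" by (rule field_from_type_algebra)
  show ?thesis by (rule inv_char) (simp_all add: ring_of_type_algebra_def assms)
qed

text \<open>Products and inverses stay in the set because only \<open>s\<^sup>2\<close>, which is
  rational, enters their coordinates: an inverse is the conjugate divided by the norm
  \<open>a\<^sup>2 + b\<^sup>2 * s\<^sup>2\<close>.\<close>

lemma rat_adjoin_ii_mult:
  fixes s :: real
  assumes "s\<^sup>2 \<in> \<rat>"
  shows "rat_adjoin (\<i> * of_real s) = {Complex a (b * s) | a b. a \<in> \<rat> \<and> b \<in> \<rat>}" (is "?F = ?K")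
proof
  have K: "Complex a (b * s) \<in> ?K" if "a \<in> \<rat>" "b \<in> \<rat>" for a b using that by blast
  show "?F \<subseteq> ?K"
  proof
    fix x assume "x \<in> ?F"
    thus "x \<in> ?K" unfolding rat_adjoin_def
    proof induction
      case one
      show ?case using K[of 1 0] by (simp add: ring_of_type_algebra_def one_complex.code)
    next
      case (incl h)
      show ?case
      proof (cases "h \<in> \<rat>")
        case True
        then obtain q where "h = of_rat q" by (rule Rats_cases)
        thus ?thesis using K[of "of_rat q" 0]
          by (cases q) (simp add: of_rat_rat complex_eq_iff Complex_eq)
      next
        case False
        thus ?thesis using incl K[of 0 1] by (auto simp: Complex_eq)
      qed
    next
      case (a_inv h)
      then obtain a b where h: "h = Complex a (b * s)" "a \<in> \<rat>" "b \<in> \<rat>" by blast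
      have "- h = Complex (- a) (- b * s)" unfolding h by (simp add: complex_eq_iff)
      also have "\<dots> \<in> ?K" by (rule K) (use h in auto)
      finally show ?case unfolding a_inv_ring_of_type_algebra .
    next
      case (m_inv h)
      then obtain a b where h: "h = Complex a (b * s)" "a \<in> \<rat>" "b \<in> \<rat>" by blast
      have "inverse h = Complex (a / (a\<^sup>2 + b\<^sup>2 * s\<^sup>2)) (- b / (a\<^sup>2 + b\<^sup>2 * s\<^sup>2) * s)"
        unfolding h complex_inverse by (simp add: power_mult_distrib)
      also have "\<dots> \<in> ?K"
        by (rule K) (use assms h in auto)
      finally show ?case
        using m_inv by (subst m_inv_ring_of_type_algebra) (auto simp: ring_of_type_algebra_def)
    next
      case (eng_add h1 h2)
      then obtain a b a' b' where
        h: "h1 = Complex a (b * s)" "h2 = Complex a' (b' * s)"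
        and Q: "a \<in> \<rat>" "b \<in> \<rat>" "a' \<in> \<rat>" "b' \<in> \<rat>"
        by blast
      have "h1 + h2 = Complex (a + a') ((b + b') * s)"
        unfolding h by (simp add: complex_eq_iff algebra_simps)
      also have "\<dots> \<in> ?K" by (rule K) (use Q in auto)
      finally show ?case by (simp add: ring_of_type_algebra_def)
    next
      case (eng_mult h1 h2)
      then obtain a b a' b' where
        h: "h1 = Complex a (b * s)" "h2 = Complex a' (b' * s)"
        and Q: "a \<in> \<rat>" "b \<in> \<rat>" "a' \<in> \<rat>" "b' \<in> \<rat>"
        by blast
      have "h1 * h2 = Complex (a * a' - b * b' * s\<^sup>2) ((a * b' + b * a') * s)"
        unfolding h by (simp add: complex_eq_iff algebra_simps power2_eq_square)
      also have "\<dots> \<in> ?K" by (rule K) (use assms Q in auto)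
      finally show ?case by (simp add: ring_of_type_algebra_def)
    qed
  qed
  show "?K \<subseteq> ?F"
  proof clarify
    fix a b :: real assume ab: "a \<in> \<rat>" "b \<in> \<rat>"
    have add: "x + y \<in> ?F" and mult: "x * y \<in> ?F" if "x \<in> ?F" "y \<in> ?F" for x y
      using generate_field.eng_add[OF that[unfolded rat_adjoin_def]]
        generate_field.eng_mult[OF that[unfolded rat_adjoin_def]]
      by (simp_all add: rat_adjoin_def ring_of_type_algebra_def)
    have rat: "of_real q \<in> ?F" if "q \<in> \<rat>" for q
    proof -
      from that obtain r where "q = of_rat r" by (rule Rats_cases)
      hence "(of_real q :: complex) \<in> \<rat>" by (cases r) (simp add: of_rat_rat)
      thus ?thesis by (auto simp: rat_adjoin_def intro: generate_field.incl)
    qed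
    have gen: "\<i> * of_real s \<in> ?F" by (auto simp: rat_adjoin_def intro: generate_field.incl)
    have "of_real a + of_real b * (\<i> * of_real s) \<in> ?F"
      by (rule add[OF rat[OF ab(1)] mult[OF rat[OF ab(2)] gen]])
    also have "of_real a + of_real b * (\<i> * of_real s) = Complex a (b * s)"
      by (simp add: complex_eq_iff)
    finally show "Complex a (b * s) \<in> ?F" .
  qed
qed

section \<open>Integers of an imaginary quadratic field\<close>

text \<open>If \<open>x\<close> is \<open>a / b\<close> in lowest terms, then
  \<open>b\<^sup>2\<close> divides \<open>m * a\<^sup>2\<close>, hence \<open>m\<close>, and so
  \<open>b\<close> is a unit.\<close>

lemma squarefree_mult_square_int:
  fixes x :: real and m :: int
  assumes "squarefree m" and "x \<in> \<rat>" and "of_int m * x\<^sup>2 \<in> \<int>"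
  shows "x \<in> \<int>"
proof -
  obtain a b where ab: "b > 0" "coprime a b" "x = of_int a / of_int b"
    using assms(2) by (rule Rats_cases')
  obtain k where "of_int m * x\<^sup>2 = of_int k" using assms(3) by (elim Ints_cases)
  hence "real_of_int (m * a\<^sup>2) = of_int (k * b\<^sup>2)"
    using ab by (simp add: power_divide field_simps)
  hence "m * a\<^sup>2 = k * b\<^sup>2" by (simp only: of_int_eq_iff)
  hence "b\<^sup>2 dvd m * a\<^sup>2" by simp
  moreover have "coprime (b\<^sup>2) (a\<^sup>2)" using ab(2) by (simp add: coprime_commute)
  ultimately have "b\<^sup>2 dvd m" by (simp add: coprime_dvd_mult_left_iff)
  hence "b dvd 1" using assms(1) by (auto dest: squarefreeD)
  thus ?thesis using ab by simp
qed

text \<open>\<open>\<i> * s\<close> is a square root of \<open>m\<close>, so an element with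
  coordinates \<open>a\<close>, \<open>b\<close> has trace \<open>2 * a\<close> and norm
  \<open>a\<^sup>2 - m * b\<^sup>2\<close>. Both being integers forces \<open>2 * b\<close> to be
  one as well, by squarefreeness.\<close>

lemma ring_of_integers_imaginary_quadratic:
  fixes m :: int and s :: real
  assumes "squarefree m" and s2: "s\<^sup>2 = - of_int m"
  shows "ring_of_integers (rat_adjoin (\<i> * of_real s)) =
    {Complex (of_int A / 2) (of_int B / 2 * s) | A B. 4 dvd A\<^sup>2 - m * B\<^sup>2}" (is "?O = ?L")
proof
  have F: "rat_adjoin (\<i> * of_real s) = {Complex a (b * s) | a b. a \<in> \<rat> \<and> b \<in> \<rat>}"
    by (rule rat_adjoin_ii_mult) (simp add: s2)
  show "?O \<subseteq> ?L"
  proof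
    fix x assume "x \<in> ?O"
    then obtain a b where x: "x = Complex a (b * s)" and ab: "a \<in> \<rat>" "b \<in> \<rat>"
      and int: "algebraic_int x"
      unfolding ring_of_integers_def F by blast
    have norm: "(cmod x)\<^sup>2 = a\<^sup>2 - of_int m * b\<^sup>2"
      unfolding x cmod_power2 by (simp add: power_mult_distrib s2)
    have "2 * Re x \<in> \<rat>" "(cmod x)\<^sup>2 \<in> \<rat>" unfolding norm using ab by (simp_all add: x)
    note int = algebraic_int_trace_norm_Ints[OF int this]
    obtain A where A: "2 * a = of_int A" using int(1) by (auto simp: x elim: Ints_cases)
    obtain N where N: "a\<^sup>2 - of_int m * b\<^sup>2 = of_int N"
      using int(2) unfolding norm by (auto elim: Ints_cases)
    have "of_int m * (2 * b)\<^sup>2 = (2 * a)\<^sup>2 - 4 * of_int N"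
      unfolding N[symmetric] by (simp add: power_mult_distrib)
    also have "\<dots> \<in> \<int>" unfolding A by simp
    finally have "2 * b \<in> \<int>"
      by (rule squarefree_mult_square_int[OF assms(1), rotated]) (use ab(2) in simp)
    then obtain B where B: "2 * b = of_int B" by (auto elim: Ints_cases)
    have "real_of_int (A\<^sup>2 - m * B\<^sup>2) = of_int (4 * N)"
      using N by (simp add: A[symmetric] B[symmetric] power_mult_distrib)
    hence "4 dvd A\<^sup>2 - m * B\<^sup>2" by (simp only: of_int_eq_iff) simp
    moreover have "x = Complex (of_int A / 2) (of_int B / 2 * s)"
      unfolding x A[symmetric] B[symmetric] by simp
    ultimately show "x \<in> ?L" by blast
  qed
  show "?L \<subseteq> ?O"
  proof clarify
    fix A B assume "4 dvd A\<^sup>2 - m * B\<^sup>2"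
    then obtain k where k: "A\<^sup>2 - m * B\<^sup>2 = 4 * k" by blast
    define x where "x = Complex (of_int A / 2) (of_int B / 2 * s)"
    \<comment> \<open>\<open>x\<close> has trace \<open>A\<close> and norm \<open>k\<close>, so it
      is a root of the monic \<open>X^2 - A X + k\<close>.\<close>
    have "of_int k = (real_of_int (A\<^sup>2 - m * B\<^sup>2)) / 4" unfolding k by simp
    also have "\<dots> = (of_int A / 2)\<^sup>2 + (of_int B / 2 * s)\<^sup>2"
      by (simp add: power_mult_distrib power_divide s2)
    finally have "x * x = of_int A * x - of_int k"
      by (simp add: x_def complex_eq_iff power2_eq_square algebra_simps)
    hence "poly (map_poly of_int [:k, - A, 1:]) x = 0"
      by (simp add: map_poly_pCons algebra_simps)
    moreover have "Polynomial.lead_coeff [:k, - A, 1:] = 1" by simp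
    ultimately have "algebraic_int x" unfolding algebraic_int_altdef_ipoly by blast
    moreover have "x \<in> rat_adjoin (\<i> * of_real s)"
    proof -
      have "real_of_int A / 2 \<in> \<rat>" "real_of_int B / 2 \<in> \<rat>" by simp_all
      thus ?thesis unfolding F x_def by blast
    qed
    ultimately show "Complex (of_int A / 2) (of_int B / 2 * s) \<in> ?O"
      by (simp add: ring_of_integers_def x_def)
  qed
qed

section \<open>Residues modulo 4, and comparison of the lattices\<close>

text \<open>A square is 0 or 1 modulo 4 according to parity, which leaves finitely many cases to
  check.\<close>

lemma four_dvd_square_diff_iff:
  fixes m A B :: int
  shows "4 dvd A\<^sup>2 - m * B\<^sup>2 \<longleftrightarrow> 4 dvd A mod 2 - (m mod 4) * (B mod 2)"
proof -
  have sq: "x\<^sup>2 mod 4 = x mod 2" for x :: int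
  proof (cases "even x")
    case True
    then obtain y where "x = 2 * y" by (rule evenE)
    thus ?thesis by (simp add: power2_eq_square)
  next
    case False
    then obtain y where "x = 2 * y + 1" by (rule oddE)
    hence "x\<^sup>2 = 1 + 4 * (y * y + y)"
      by (simp add: power2_eq_square algebra_simps)
    hence "x\<^sup>2 mod 4 = 1" by (simp only: mod_mult_self2) simp
    thus ?thesis using False by (simp add: mod_2_eq_odd)
  qed
  have "(A\<^sup>2 - m * B\<^sup>2) mod 4 = (A\<^sup>2 mod 4 - (m mod 4) * (B\<^sup>2 mod 4)) mod 4"
    by (intro mod_diff_cong mod_mult_cong) simp_all
  thus ?thesis unfolding sq dvd_eq_mod_eq_0 by simp
qed

text \<open>Unless both numbers are even, the value is congruent to 1, \<open>- m\<close> or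
  \<open>1 - m\<close>, and none of these is divisible by 4.\<close>

lemma four_dvd_square_diff_iff_even:
  fixes m A B :: int
  assumes "[m = 2] (mod 4) \<or> [m = 3] (mod 4)"
  shows "4 dvd A\<^sup>2 - m * B\<^sup>2 \<longleftrightarrow> even A \<and> even B"
proof -
  have "m mod 4 = 2 \<or> m mod 4 = 3" using assms by (simp add: cong_def)
  thus ?thesis unfolding four_dvd_square_diff_iff[of A m] mod_2_eq_odd
    by (cases "even A"; cases "even B") auto
qed

lemma four_dvd_square_diff_iff_parity_eq:
  fixes m A B :: int
  assumes "[m = 1] (mod 4)"
  shows "4 dvd A\<^sup>2 - m * B\<^sup>2 \<longleftrightarrow> even (A - B)"
proof -
  have "m mod 4 = 1" using assms by (simp add: cong_def)
  thus ?thesis unfolding four_dvd_square_diff_iff[of A m] mod_2_eq_odd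
    by (cases "even A"; cases "even B") auto
qed

theorem theorem3p2:
  fixes m :: int and sqrt_m :: complex and \<theta> :: real
  assumes "m < 0" and "squarefree m"
    and "sqrt_m = \<i> * complex_of_real (sqrt \<bar>real_of_int m\<bar>)"
    and "\<theta> = Arg (1 + sqrt_m)"
  shows "([m = 2] (mod 4) \<or> [m = 3] (mod 4) \<longrightarrow>
            ring_of_integers (rat_adjoin sqrt_m) = origami_set {1, \<i>, cis \<theta>})
       \<and> ([m = 1] (mod 4) \<longrightarrow>
            ring_of_integers (rat_adjoin sqrt_m) = origami_set {1, cis \<theta>, cis (pi - \<theta>)})"
proof -
  define s where "s = sqrt \<bar>real_of_int m\<bar>"
  have s: "s \<noteq> 0" "s\<^sup>2 = - of_int m" using assms(1) by (simp_all add: s_def)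
  have sm: "sqrt_m = \<i> * of_real s" by (simp add: assms(3) s_def)
  define R where "R = cmod (1 + sqrt_m)"
  have polar: "1 + sqrt_m = of_real R * cis \<theta>"
    using rcis_cmod_Arg[of "1 + sqrt_m"] by (simp add: R_def assms(4) rcis_def)
  have cis_diff: "cis (pi - \<theta>) = - cnj (cis \<theta>)"
    by (simp add: complex_eq_iff)
  note ints = ring_of_integers_imaginary_quadratic[OF assms(2) s(2), folded sm]
  show ?thesis
  proof (intro conjI impI)
    assume m: "[m = 2] (mod 4) \<or> [m = 3] (mod 4)"
    \<comment> \<open>Subtracting 1 from \<open>1 + sqrt_m\<close> leaves \<open>s\<close> times
      \<open>\<i>\<close>, so \<open>\<i>\<close> takes the place of the third direction.\<close>
    interpret lattice_directions "1 + sqrt_m" "cis \<theta>" \<i> R s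
    proof
      show "1 + sqrt_m = of_real R * cis \<theta>" by (rule polar)
    qed (use s(1) in \<open>simp_all add: sm\<close>)
    have "ring_of_integers (rat_adjoin sqrt_m) = {of_int a + of_int b * (1 + sqrt_m) | a b. True}"
    proof (intro equalityI subsetI)
      fix x assume "x \<in> ring_of_integers (rat_adjoin sqrt_m)"
      then obtain A B where x: "x = Complex (of_int A / 2) (of_int B / 2 * s)" "even A" "even B"
        unfolding ints using four_dvd_square_diff_iff_even[OF m] by blast
      then obtain a b where "A = 2 * a" "B = 2 * b" by (auto elim!: evenE)
      \<comment> \<open>\<open>x\<close> is \<open>a + b * sqrt_m\<close>; passing to the basis
        \<open>1\<close>, \<open>1 + sqrt_m\<close> lowers the first coordinate by
        \<open>b\<close>.\<close>
      hence "x = of_int (a - b) + of_int b * (1 + sqrt_m)"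
        unfolding x(1) by (simp add: complex_eq_iff sm)
      thus "x \<in> {of_int a + of_int b * (1 + sqrt_m) | a b. True}" by blast
    next
      fix x assume "x \<in> {of_int a + of_int b * (1 + sqrt_m) | a b. True}"
      then obtain a b where x: "x = of_int a + of_int b * (1 + sqrt_m)" by blast
      have "x = Complex (of_int (2 * (a + b)) / 2) (of_int (2 * b) / 2 * s)"
        unfolding x by (simp add: complex_eq_iff sm)
      moreover have "4 dvd (2 * (a + b))\<^sup>2 - m * (2 * b)\<^sup>2"
        unfolding four_dvd_square_diff_iff_even[OF m] by simp
      ultimately show "x \<in> ring_of_integers (rat_adjoin sqrt_m)" unfolding ints by blast
    qed
    thus "ring_of_integers (rat_adjoin sqrt_m) = origami_set {1, \<i>, cis \<theta>}"
      using origami_eq by (simp add: insert_commute)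
  next
    assume m: "[m = 1] (mod 4)"
    define w where "w = (1 + sqrt_m) / 2"
    have w: "Re w = 1 / 2" "Im w = s / 2" by (simp_all add: w_def sm)
    interpret lattice_directions w "cis \<theta>" "cis (pi - \<theta>)" "R / 2" "R / 2"
    proof
      \<comment> \<open>Since \<open>Re w\<close> is 1/2, subtracting 1 reflects \<open>w\<close> in
        the imaginary axis, which turns the angle \<open>\<theta>\<close> into
        \<open>pi - \<theta>\<close> and keeps the length.\<close>
      have "w - 1 = - cnj w" by (simp add: complex_eq_iff w)
      thus "w - 1 = of_real (R / 2) * cis (pi - \<theta>)"
        unfolding cis_diff w_def polar by simp
      show "w = of_real (R / 2) * cis \<theta>" unfolding w_def polar by simp
    qed (use s(1) in \<open>simp_all add: w\<close>)
    have "ring_of_integers (rat_adjoin sqrt_m) = {of_int a + of_int b * w | a b. True}"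
    proof (intro equalityI subsetI)
      fix x assume "x \<in> ring_of_integers (rat_adjoin sqrt_m)"
      then obtain A B where x: "x = Complex (of_int A / 2) (of_int B / 2 * s)" "even (A - B)"
        unfolding ints using four_dvd_square_diff_iff_parity_eq[OF m] by blast
      then obtain a where "A - B = 2 * a" by (elim evenE)
      \<comment> \<open>Equal parity lets \<open>(A + B * sqrt_m) / 2\<close> be written as
        \<open>a + B * w\<close>.\<close>
      hence "A = 2 * a + B" by simp
      hence "x = of_int a + of_int B * w"
        unfolding x(1) by (simp add: complex_eq_iff w add_divide_distrib)
      thus "x \<in> {of_int a + of_int b * w | a b. True}" by blast
    next
      fix x assume "x \<in> {of_int a + of_int b * w | a b. True}"
      then obtain a b where x: "x = of_int a + of_int b * w" by blast
      have "x = Complex (of_int (2 * a + b) / 2) (of_int b / 2 * s)"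
        unfolding x by (simp add: complex_eq_iff w add_divide_distrib)
      moreover have "4 dvd (2 * a + b)\<^sup>2 - m * b\<^sup>2"
        unfolding four_dvd_square_diff_iff_parity_eq[OF m] by simp
      ultimately show "x \<in> ring_of_integers (rat_adjoin sqrt_m)" unfolding ints by blast
    qed
    thus "ring_of_integers (rat_adjoin sqrt_m) = origami_set {1, cis \<theta>, cis (pi - \<theta>)}"
      using origami_eq by simp
  qed
qed

end
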